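(* Let $A$ and $B$ be Banach algebras and let $T:A\to B$ be a bounded cf-homomorphism [respectively a bounded wcf-homomorphism] that is bijective. Then the inverse mapping $T^{-1}:B\to A$ is a bounded cf-homomorphism [respectively a bounded wcf-homomorphism].
   Context: For a linear map $T:A\to B$ between Banach algebras, the failure of multiplicativity of $T$ is the bilinear map $S_T:A\times A\to B$, $S_T(a,b)=T(a)T(b)-T(ab)$. A bilinear map $S:E_1\times E_2\to F$ of normed spaces is compact [respectively weakly compact] if the norm closure [respectively weak closure] of $S(\{(x_1,x_2): \|x_1\|<1,\|x_2\|<1\})$ is norm compact [respectively weakly compact]. The linear map $T$ is a cf-homomorphism if $S_T$ is compact and a wcf-homomorphism if $S_T$ is weakly compact. *)

theory Defs
  imports "HOL-Analysis.Analysis"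
begin

text \<open>
  Scalars range over an arbitrary type of class \<open>real_normed_field\<close> (up to isometric isomorphism,
  the reals or the complex numbers), acting through an explicit \<open>scal\<close>, because the library has
  no class of complex normed algebras. The underlying real structure is that of the classes
  \<open>real_normed_algebra\<close> (which requires no unit) and \<open>banach\<close>.
\<close>

locale banach_algebra = vector_space scal
  for scal :: "'k::real_normed_field \<Rightarrow> 'a::{real_normed_algebra,banach} \<Rightarrow> 'a" +
  assumes scale_of_real: "scal (of_real r) x = r *\<^sub>R x"
    and norm_scale: "norm (scal c x) = norm c * norm x"
    and mult_scale_left: "scal c x * y = scal c (x * y)"
    and mult_scale_right: "x * scal c y = scal c (x * y)"

definition bounded_map :: "('a::real_normed_vector \<Rightarrow> 'b::real_normed_vector) \<Rightarrow> bool" where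
  "bounded_map f \<longleftrightarrow> (\<exists>K. \<forall>x. norm (f x) \<le> K * norm x)"

definition dual_space ::
    "('k::real_normed_field \<Rightarrow> 'a::real_normed_vector \<Rightarrow> 'a) \<Rightarrow> ('a \<Rightarrow> 'k) set" where
  "dual_space scal = {f. Vector_Spaces.linear scal (*) f \<and> bounded_map f}"

definition weak_topology ::
    "('k::real_normed_field \<Rightarrow> 'a::real_normed_vector \<Rightarrow> 'a) \<Rightarrow> 'a topology" where
  "weak_topology scal =
     topology_generated_by {f -` U | f U. f \<in> dual_space scal \<and> open U}"

definition unit_balls_image ::
    "('a::real_normed_vector \<Rightarrow> 'b::real_normed_vector \<Rightarrow> 'c) \<Rightarrow> 'c set" where
  "unit_balls_image S = {S x y | x y. norm x < 1 \<and> norm y < 1}"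

text \<open>The next two notions are meant for bilinear \<open>S\<close>; the failure of multiplicativity of a
  linear map is always bilinear.\<close>

definition compact_bilinear ::
    "('a::real_normed_vector \<Rightarrow> 'b::real_normed_vector \<Rightarrow> 'c::real_normed_vector) \<Rightarrow> bool" where
  "compact_bilinear S \<longleftrightarrow> compact (closure (unit_balls_image S))"

definition weakly_compact_bilinear ::
    "('k::real_normed_field \<Rightarrow> 'c::real_normed_vector \<Rightarrow> 'c) \<Rightarrow>
     ('a::real_normed_vector \<Rightarrow> 'b::real_normed_vector \<Rightarrow> 'c) \<Rightarrow> bool" where
  "weakly_compact_bilinear scal S \<longleftrightarrow>
     compactin (weak_topology scal) (weak_topology scal closure_of unit_balls_image S)"

definition mult_failure ::
    "('a::real_normed_algebra \<Rightarrow> 'b::real_normed_algebra) \<Rightarrow> 'a \<Rightarrow> 'a \<Rightarrow> 'b" where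
  "mult_failure T a b = T a * T b - T (a * b)"

definition cf_homomorphism ::
    "('k::real_normed_field \<Rightarrow> 'a::real_normed_algebra \<Rightarrow> 'a) \<Rightarrow>
     ('k \<Rightarrow> 'b::real_normed_algebra \<Rightarrow> 'b) \<Rightarrow> ('a \<Rightarrow> 'b) \<Rightarrow> bool" where
  "cf_homomorphism scaleA scaleB T \<longleftrightarrow>
     Vector_Spaces.linear scaleA scaleB T \<and> compact_bilinear (mult_failure T)"

definition wcf_homomorphism ::
    "('k::real_normed_field \<Rightarrow> 'a::real_normed_algebra \<Rightarrow> 'a) \<Rightarrow>
     ('k \<Rightarrow> 'b::real_normed_algebra \<Rightarrow> 'b) \<Rightarrow> ('a \<Rightarrow> 'b) \<Rightarrow> bool" where
  "wcf_homomorphism scaleA scaleB T \<longleftrightarrow>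
     Vector_Spaces.linear scaleA scaleB T \<and> weakly_compact_bilinear scaleB (mult_failure T)"

end

theory Submission
  imports Defs
begin

text \<open>
  Writing \<open>R = T\<^sup>-\<^sup>1\<close>, one has \<open>S\<^sub>R(T a, T b) = - R (S\<^sub>T(a, b))\<close>. By the open mapping theorem \<open>R\<close> is
  bounded, say by \<open>K\<close>, so the image of the open unit balls under \<open>S\<^sub>R\<close> lies in the image of the open
  unit balls under \<open>S\<^sub>T\<close>, transported by \<open>- K\<^sup>2 R\<close>. This linear map is continuous for the norm
  topologies and for the weak topologies, hence preserves relative compactness.
\<close>

section \<open>The bounded inverse theorem\<close>

text \<open>By Baire category in the codomain, the closure of the image of some ball contains a
  ball. Differences of points approximated in it reach every direction \<open>z\<close>, and
  homogeneity makes the bound uniform. Allowing the error \<open>norm z / 2\<close> is what lets the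
  correction be iterated later.\<close>

lemma bounded_linear_surj_imp_approx_preimage:
  fixes f :: "'a::real_normed_vector \<Rightarrow> 'b::banach"
  assumes "bounded_linear f" and "surj f"
  shows "\<exists>C\<ge>0. \<forall>z. \<exists>x. norm x \<le> C * norm z \<and> norm (z - f x) \<le> norm z / 2"
proof -
  interpret bounded_linear f by fact
  define V where "V n = closure (f ` ball 0 (real n))" for n
  have "\<exists>n. interior (V n) \<noteq> {}"
  proof (rule ccontr)
    assume "\<not> ?thesis"
    then have "euclidean interior_of \<Union>(range V) = {}"
      by (intro Baire_category_alt)
        (auto simp: V_def completely_metrizable_space_euclidean)
    moreover have "\<Union>(range V) = UNIV"
    proof -
      have "y \<in> \<Union>(range V)" for y
      proof -
        obtain x where "y = f x" using assms(2) by blast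
        moreover obtain n where "norm x < real n" using reals_Archimedean2 by blast
        ultimately show ?thesis
          by (auto simp: V_def intro!: exI[of _ n] closure_subset[THEN subsetD])
      qed
      then show ?thesis by blast
    qed
    ultimately show False by simp
  qed
  then obtain n y0 where "y0 \<in> interior (V n)" by blast
  then obtain e where e: "e > 0" "ball y0 e \<subseteq> V n"
    by (meson mem_interior)
  \<comment> \<open>With \<open>t = e / (2 * norm z)\<close> as chosen below, the bound
    \<open>2 * real n / t\<close> equals \<open>C * norm z\<close>.\<close>
  define C where "C = 4 * real n / e"
  have "\<exists>x. norm x \<le> C * norm z \<and> norm (z - f x) \<le> norm z / 2" for z
  proof (cases "z = 0")
    case True
    then show ?thesis by (intro exI[of _ 0]) simp
  next
    case False
    \<comment> \<open>Rescales \<open>z\<close> to length \<open>e / 2\<close>, so that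
      \<open>y0 + t *\<^sub>R z\<close> stays inside \<open>ball y0 e\<close>.\<close>
    define t where "t = e / (2 * norm z)"
    have t: "t > 0" using e False by (simp add: t_def)
    have tz: "t * norm z = e / 2" using False by (simp add: t_def)
    have "y0 + t *\<^sub>R z \<in> V n" "y0 \<in> V n"
      using e t tz by (auto intro!: subsetD[OF e(2)] simp: dist_norm)
    then have "\<exists>u\<in>f ` ball 0 n. dist u (y0 + t *\<^sub>R z) < e / 8"
      "\<exists>u\<in>f ` ball 0 n. dist u y0 < e / 8"
      using e(1) unfolding V_def closure_approachable by (meson divide_pos_pos zero_less_numeral)+
    then obtain a b where ab: "norm a < n" "norm b < n"
      "dist (f a) (y0 + t *\<^sub>R z) < e / 8" "dist (f b) y0 < e / 8"
      by auto
    have nab: "norm (a - b) \<le> 2 * real n"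
      using ab(1,2) norm_triangle_ineq4[of a b] by linarith
    have nf: "norm (t *\<^sub>R z - f (a - b)) \<le> e / 4"
    proof -
      \<comment> \<open>The centre \<open>y0\<close> cancels in the difference. Two errors below
        \<open>e / 8\<close> leave at most \<open>e / 4\<close>, which becomes
        \<open>norm z / 2\<close> after division by \<open>t\<close>.\<close>
      have "t *\<^sub>R z - f (a - b) = (f b - y0) - (f a - (y0 + t *\<^sub>R z))"
        by (simp add: diff)
      then have "norm (t *\<^sub>R z - f (a - b)) \<le>
          norm (f b - y0) + norm (f a - (y0 + t *\<^sub>R z))"
        by (metis norm_triangle_ineq4)
      then show ?thesis using ab(3,4) unfolding dist_norm by linarith
    qed
    define x where "x = (1/t) *\<^sub>R (a - b)"
    have "norm x = norm (a - b) / t" using t by (simp add: x_def)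
    also have "\<dots> \<le> 2 * real n / t" using nab t by (simp add: divide_right_mono)
    also have "\<dots> = C * norm z" by (simp add: C_def t_def)
    finally have "norm x \<le> C * norm z" .
    moreover have "z - f x = (1/t) *\<^sub>R (t *\<^sub>R z - f (a - b))"
      using t by (simp add: x_def scaleR diff scaleR_diff_right)
    then have "norm (z - f x) = norm (t *\<^sub>R z - f (a - b)) / t" using t by simp
    moreover have "\<dots> \<le> (e / 4) / t" using nf t by (intro divide_right_mono) auto
    moreover have "(e / 4) / t = norm z / 2" using e(1) by (simp add: t_def)
    ultimately show ?thesis by (intro exI[of _ x]) simp
  qed
  moreover have "C \<ge> 0" using e by (simp add: C_def)
  ultimately show ?thesis by blast
qed

text \<open>Successive approximation: each residual is again approximated, so the residuals halve
  and the corrections are dominated by a geometric series. Completeness of the domain makes the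
  corrections sum to an exact preimage.\<close>

lemma bounded_linear_surj_imp_bounded_preimage:
  fixes f :: "'a::banach \<Rightarrow> 'b::banach"
  assumes "bounded_linear f" and "surj f"
  shows "\<exists>K. \<forall>z. \<exists>x. f x = z \<and> norm x \<le> K * norm z"
proof -
  interpret bounded_linear f by fact
  obtain C g where C: "C \<ge> 0"
    and g: "\<And>z. norm (g z) \<le> C * norm z" "\<And>z. norm (z - f (g z)) \<le> norm z / 2"
    using bounded_linear_surj_imp_approx_preimage[OF assms] by metis
  have "\<exists>x. f x = z \<and> norm x \<le> 2 * C * norm z" for z
  proof -
    \<comment> \<open>\<open>r k\<close> is the residual left after \<open>k\<close> corrections,
      starting from \<open>r 0 = z\<close>. The images of the corrections telescope to
      \<open>z - r n\<close>.\<close>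
    define r where "r k = ((\<lambda>y. y - f (g y)) ^^ k) z" for k
    have r_Suc: "r (Suc k) = r k - f (g (r k))" for k by (simp add: r_def)
    have r_le: "norm (r k) \<le> norm z * (1/2) ^ k" for k
    proof (induction k)
      case (Suc k)
      then show ?case using g(2)[of "r k"] by (simp add: r_Suc)
    qed (simp add: r_def)
    have gr_le: "norm (g (r k)) \<le> C * norm z * (1/2) ^ k" for k
      using g(1)[of "r k"] mult_left_mono[OF r_le[of k] C] by (simp add: mult.assoc)
    have geo: "(\<lambda>k. C * norm z * (1/2) ^ k) sums (C * norm z * 2)"
      using geometric_sums[of "1/2::real"] by (intro sums_mult) simp
    have summ: "summable (\<lambda>k. g (r k))"
      by (rule summable_comparison_test'[OF sums_summable[OF geo]]) (rule gr_le)
    have partial: "(\<Sum>k<n. f (g (r k))) = z - r n" for n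
      by (induction n) (auto simp: r_Suc, simp add: r_def)
    have "r \<longlonglongrightarrow> 0"
    proof (rule Lim_null_comparison)
      show "\<forall>\<^sub>F n in sequentially. norm (r n) \<le> norm z * (1/2) ^ n" using r_le by simp
      show "(\<lambda>n. norm z * (1/2) ^ n) \<longlonglongrightarrow> 0"
        by (intro tendsto_mult_right_zero LIMSEQ_realpow_zero) auto
    qed
    then have "(\<lambda>k. f (g (r k))) sums z"
      unfolding sums_def partial by (auto intro: tendsto_eq_intros)
    moreover have "(\<lambda>k. f (g (r k))) sums f (\<Sum>k. g (r k))"
      using summ by (intro sums summable_sums)
    ultimately have "f (\<Sum>k. g (r k)) = z" by (metis sums_unique2)
    moreover have "norm (\<Sum>k. g (r k)) \<le> C * norm z * 2"
      using norm_sums_le[OF summable_sums[OF summ] geo] gr_le by blast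
    ultimately show ?thesis by (auto simp: mult_ac)
  qed
  then show ?thesis by blast
qed

section \<open>The weak topology\<close>

lemma vector_space_mult: "vector_space ((*) :: 'k::field \<Rightarrow> 'k \<Rightarrow> 'k)"
  by unfold_locales (simp_all add: algebra_simps)

text \<open>The zero functional belongs to the dual, so the whole space is itself one of the
  generating sets.\<close>

lemma topspace_weak_topology:
  assumes "vector_space scal"
  shows "topspace (weak_topology scal) = UNIV"
proof -
  have "(\<lambda>_. 0) \<in> dual_space scal"
    using assms vector_space_mult
    by (auto simp: dual_space_def Vector_Spaces.linear_iff bounded_map_def intro: exI[of _ 0])
  then have "(\<lambda>_. 0) -` UNIV \<subseteq> topspace (weak_topology scal)"
    unfolding weak_topology_def topology_generated_by_topspace by (blast intro: open_UNIV)
  then show ?thesis by auto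
qed

lemma bounded_map_compose:
  assumes "bounded_map f" "bounded_map h"
  shows "bounded_map (h \<circ> f)"
proof -
  obtain K L where K: "\<And>x. norm (f x) \<le> K * norm x" and L: "\<And>x. norm (h x) \<le> L * norm x"
    using assms unfolding bounded_map_def by blast
  \<comment> \<open>The definition of \<open>bounded_map\<close> fixes no sign for the bound;
    monotonicity of multiplication requires \<open>\<bar>L\<bar>\<close>.\<close>
  have "norm (h (f x)) \<le> (\<bar>L\<bar> * K) * norm x" for x
  proof -
    have "norm (h (f x)) \<le> \<bar>L\<bar> * norm (f x)"
      by (rule order_trans[OF L]) (simp add: mult_right_mono)
    also have "\<dots> \<le> \<bar>L\<bar> * (K * norm x)" by (simp add: K mult_left_mono)
    finally show ?thesis by (simp add: mult.assoc)
  qed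
  then show ?thesis unfolding bounded_map_def comp_def by blast
qed

lemma bounded_map_scaleR_compose:
  fixes f :: "'a::real_normed_vector \<Rightarrow> 'b::real_normed_vector"
  assumes "bounded_map f"
  shows "bounded_map (\<lambda>x. c *\<^sub>R f x)"
proof -
  have "bounded_map (\<lambda>y::'b. c *\<^sub>R y)"
    unfolding bounded_map_def by (intro exI[of _ "\<bar>c\<bar>"]) simp
  then show ?thesis using bounded_map_compose[OF assms] by (simp add: comp_def)
qed

text \<open>Composing a bounded functional with \<open>f\<close> gives a bounded functional, so
  preimages of subbasic open sets are subbasic open.\<close>

lemma continuous_map_weak_topology:
  assumes "Vector_Spaces.linear s1 s2 f" and "bounded_map f"
  shows "continuous_map (weak_topology s1) (weak_topology s2) f"
proof -
  have vs: "vector_space s1" "vector_space s2" using assms(1) by (auto simp: Vector_Spaces.linear_iff)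
  have "openin (weak_topology s1) (f -` V \<inter> topspace (weak_topology s1))"
    if V: "V \<in> {\<phi> -` U | \<phi> U. \<phi> \<in> dual_space s2 \<and> open U}" for V
  proof -
    obtain \<phi> U where \<phi>: "V = \<phi> -` U" "\<phi> \<in> dual_space s2" "open U" using V by blast
    then have "\<phi> \<circ> f \<in> dual_space s1"
      using assms bounded_map_compose Vector_Spaces.linear_compose
      unfolding dual_space_def by blast
    then have "openin (weak_topology s1) ((\<phi> \<circ> f) -` U)"
      unfolding weak_topology_def using \<phi>(3) by (intro topology_generated_by_Basis) blast
    then show ?thesis
      by (simp add: \<phi>(1) topspace_weak_topology[OF vs(1)] vimage_comp)
  qed
  moreover have "\<Union>{\<phi> -` U | \<phi> U. \<phi> \<in> dual_space s2 \<and> open U} = UNIV"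
    using topspace_weak_topology[OF vs(2)]
    by (simp only: weak_topology_def topology_generated_by_topspace)
  ultimately show ?thesis
    unfolding weak_topology_def[of s2] continuous_on_generated_topo_iff
    by (intro conjI allI impI) simp_all
qed

section \<open>Inverses of cf-homomorphisms\<close>

text \<open>Passes from linearity over \<open>'k\<close> to real linearity, since real scalars act
  through \<open>of_real\<close> on both sides.\<close>

lemma bounded_linear_if_bounded_map:
  assumes "banach_algebra s1" "banach_algebra s2"
    and "Vector_Spaces.linear s1 s2 f" "bounded_map f"
  shows "bounded_linear f"
proof -
  interpret s1: banach_algebra s1 by fact
  interpret s2: banach_algebra s2 by fact
  obtain K where "\<And>x. norm (f x) \<le> K * norm x"
    using assms(4) unfolding bounded_map_def by blast
  moreover have "f (r *\<^sub>R x) = r *\<^sub>R f x" for r x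
    using assms(3) unfolding Vector_Spaces.linear_iff by (metis s1.scale_of_real s2.scale_of_real)
  ultimately show ?thesis
    using assms(3) unfolding Vector_Spaces.linear_iff
    by (intro bounded_linear_intro[of f K]) (auto simp: mult.commute)
qed

lemma linear_scaleR_compose:
  assumes "banach_algebra s2" and "Vector_Spaces.linear s1 s2 f"
  shows "Vector_Spaces.linear s1 s2 (\<lambda>x. c *\<^sub>R f x)"
proof -
  interpret s2: banach_algebra s2 by fact
  have "c *\<^sub>R s2 k y = s2 k (c *\<^sub>R y)" for k y
    unfolding s2.scale_of_real[symmetric] by (simp add: mult.commute)
  then show ?thesis
    using assms(2) by (simp add: Vector_Spaces.linear_iff scaleR_add_right)
qed

lemma compactin_closure_of_subset_homeomorphic_image:
  assumes "homeomorphic_map X Y g" and "compactin X (X closure_of S)"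
    and "S \<subseteq> topspace X" and "U \<subseteq> g ` S"
  shows "compactin Y (Y closure_of U)"
proof (rule closed_compactin)
  show "compactin Y (g ` (X closure_of S))"
    using assms(1,2) homeomorphic_imp_continuous_map image_compactin by blast
  show "Y closure_of U \<subseteq> g ` (X closure_of S)"
    using closure_of_mono[OF assms(4)] homeomorphic_map_closure_of[OF assms(1,3)] by blast
qed simp

lemma unit_balls_image_mult_failure_inverse:
  assumes T: "bounded_linear T" and R: "bounded_linear R"
    and RT: "\<And>a. R (T a) = a" and TR: "\<And>b. T (R b) = b"
    and K: "K > 0" "\<And>b. norm (R b) \<le> norm b * K"
  shows "unit_balls_image (mult_failure R) \<subseteq>
    (\<lambda>x. (- (K\<^sup>2)) *\<^sub>R R x) ` unit_balls_image (mult_failure T)"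
proof -
  have "mult_failure R b1 b2 \<in> (\<lambda>x. (- (K\<^sup>2)) *\<^sub>R R x) ` unit_balls_image (mult_failure T)"
    if b: "norm b1 < 1" "norm b2 < 1" for b1 b2
  proof
    \<comment> \<open>Dividing by \<open>K\<close> brings \<open>R b\<close> into the open unit
      ball. By bilinearity the two factors come out as \<open>inverse (K\<^sup>2)\<close>, which the
      factor \<open>K\<^sup>2\<close> undoes; the minus sign comes from applying \<open>R\<close> to
      the failure of \<open>T\<close>.\<close>
    let ?a = "\<lambda>b. inverse K *\<^sub>R R b"
    have "norm (?a b) < 1" if "norm b < 1" for b
    proof -
      have "norm (R b) < K" using K(2)[of b] mult_strict_right_mono[OF that K(1)] by simp
      then show ?thesis using K(1) by (simp add: field_simps)
    qed
    then show "mult_failure T (?a b1) (?a b2) \<in> unit_balls_image (mult_failure T)"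
      using b unfolding unit_balls_image_def by blast
    have "mult_failure T (?a b1) (?a b2) = inverse (K\<^sup>2) *\<^sub>R (b1 * b2 - T (R b1 * R b2))"
      by (simp add: mult_failure_def linear_simps[OF T] TR power2_eq_square scaleR_diff_right)
    then show "mult_failure R b1 b2 = (- (K\<^sup>2)) *\<^sub>R R (mult_failure T (?a b1) (?a b2))"
      using K(1) by (simp add: mult_failure_def linear_simps[OF R] RT)
  qed
  then show ?thesis unfolding unit_balls_image_def by blast
qed

theorem theorem2p12:
  fixes scaleA :: "'k::real_normed_field \<Rightarrow> 'a::{real_normed_algebra,banach} \<Rightarrow> 'a"
    and scaleB :: "'k \<Rightarrow> 'b::{real_normed_algebra,banach} \<Rightarrow> 'b"
    and T :: "'a \<Rightarrow> 'b"
  assumes "banach_algebra scaleA" and "banach_algebra scaleB"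
    and "bounded_map T" and "bij T"
  shows "(cf_homomorphism scaleA scaleB T \<longrightarrow>
            bounded_map (inv T) \<and> cf_homomorphism scaleB scaleA (inv T)) \<and>
         (wcf_homomorphism scaleA scaleB T \<longrightarrow>
            bounded_map (inv T) \<and> wcf_homomorphism scaleB scaleA (inv T))"
proof -
  interpret B: banach_algebra scaleB by fact
  have main: "bounded_map (inv T) \<and> Vector_Spaces.linear scaleB scaleA (inv T) \<and>
      (compact_bilinear (mult_failure T) \<longrightarrow> compact_bilinear (mult_failure (inv T))) \<and>
      (weakly_compact_bilinear scaleB (mult_failure T) \<longrightarrow>
        weakly_compact_bilinear scaleA (mult_failure (inv T)))"
    if lin: "Vector_Spaces.linear scaleA scaleB T"
  proof -
    note inv_T = bij_is_inj[OF assms(4), THEN inv_f_f] bij_is_surj[OF assms(4), THEN surj_f_inv_f]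
    have linR: "Vector_Spaces.linear scaleB scaleA (inv T)"
    proof -
      have "inv T (x + y) = inv T x + inv T y" "inv T (scaleB c x) = scaleA c (inv T x)" for x y c
        using lin inv_T(1)[of "inv T x + inv T y"] inv_T(1)[of "scaleA c (inv T x)"]
        by (simp_all add: Vector_Spaces.linear_iff inv_T(2))
      then show ?thesis
        using lin by (simp add: Vector_Spaces.linear_iff)
    qed
    have blT: "bounded_linear T"
      using bounded_linear_if_bounded_map[OF assms(1,2) lin assms(3)] .
    obtain K0 where "\<And>z. \<exists>x. T x = z \<and> norm x \<le> K0 * norm z"
      using bounded_linear_surj_imp_bounded_preimage[OF blT bij_is_surj[OF assms(4)]] by blast
    \<comment> \<open>By injectivity, the preimage with controlled norm is \<open>inv T z\<close>
      itself.\<close>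
    then have "norm (inv T z) \<le> K0 * norm z" for z by (metis inv_T(1))
    then have bR: "bounded_map (inv T)" unfolding bounded_map_def by blast
    have blR: "bounded_linear (inv T)"
      using bounded_linear_if_bounded_map[OF assms(2,1) linR bR] .
    obtain K where K: "K > 0" "\<And>z. norm (inv T z) \<le> norm z * K"
      using bounded_linear.pos_bounded[OF blR] by blast
    define g where "g x = (- (K\<^sup>2)) *\<^sub>R inv T x" for x
    define h where "h x = inverse (- (K\<^sup>2)) *\<^sub>R T x" for x
    \<comment> \<open>\<open>g\<close> and \<open>h\<close> are mutually inverse because
      \<open>K > 0\<close>. The topologies stay arbitrary so that the norm and the weak case both
      follow from continuity of \<open>g\<close> and \<open>h\<close>.\<close>
    have hom: "homeomorphic_map X Y g"
      if "continuous_map X Y g" "continuous_map Y X h" for X Y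
    proof -
      have "h (g x) = x" "g (h y) = y" for x y
        using K(1) inv_T
        by (simp_all add: g_def h_def linear_simps[OF blT] linear_simps[OF blR])
      then show ?thesis
        using that by (auto simp: homeomorphic_map_maps homeomorphic_maps_def)
    qed
    have lin_gh: "Vector_Spaces.linear scaleB scaleA g" "Vector_Spaces.linear scaleA scaleB h"
      unfolding g_def h_def
      by (rule linear_scaleR_compose[OF assms(1) linR])
        (rule linear_scaleR_compose[OF assms(2) lin])
    have b_gh: "bounded_map g" "bounded_map h"
      unfolding g_def h_def
      by (rule bounded_map_scaleR_compose[OF bR]) (rule bounded_map_scaleR_compose[OF assms(3)])
    have sub: "unit_balls_image (mult_failure (inv T)) \<subseteq> g ` unit_balls_image (mult_failure T)"
      using unit_balls_image_mult_failure_inverse[OF blT blR inv_T(1) inv_T(2) K]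
      by (simp add: g_def)
    have hom_norm: "homeomorphic_map euclidean euclidean g"
      using bounded_linear_if_bounded_map[OF assms(2,1) lin_gh(1) b_gh(1)]
        bounded_linear_if_bounded_map[OF assms(1,2) lin_gh(2) b_gh(2)]
      by (intro hom) (auto intro: linear_continuous_on)
    have "compact_bilinear (mult_failure (inv T))" if "compact_bilinear (mult_failure T)"
      using compactin_closure_of_subset_homeomorphic_image[OF hom_norm _ _ sub] that
      by (simp add: compact_bilinear_def)
    moreover have hom_weak: "homeomorphic_map (weak_topology scaleB) (weak_topology scaleA) g"
      by (intro hom continuous_map_weak_topology lin_gh b_gh)
    have "weakly_compact_bilinear scaleA (mult_failure (inv T))"
      if "weakly_compact_bilinear scaleB (mult_failure T)"
      using compactin_closure_of_subset_homeomorphic_image[OF hom_weak _ _ sub] that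
      by (simp add: weakly_compact_bilinear_def topspace_weak_topology[OF B.vector_space_axioms])
    ultimately show ?thesis using bR linR by blast
  qed
  then show ?thesis
    unfolding cf_homomorphism_def wcf_homomorphism_def by blast
qed

end
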